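(* For $k\ge 0$ let \[ L_k(z)=\sum_{n\ge0}\left|\{\pi\in\mathfrak D^1_{2n}(132):\mathrm{lis}(\pi)\le k\}\right| z^n \] be the generating function for $\{132,12\cdots(k+1)\}$-avoiding Dumont permutations of the first kind, and set $L_{-1}(z)=0$. Then $L_0(z)=1$ and for all $k\ge1$ \[ L_k(z)=1+\frac{zL_{k-1}(z)}{1-zL_{k-2}(z)}. \]
   Context: A permutation $\sigma\in\mathfrak S_N$ contains a pattern $\tau\in\mathfrak S_k$ if there are positions $i_1<\dots<i_k$ such that $(\sigma(i_1),\dots,\sigma(i_k))$ is order-isomorphic to $\tau$; otherwise $\sigma$ avoids $\tau$. A Dumont permutation of the first kind is a permutation $\pi\in\mathfrak S_{2n}$ such that for every $i=1,\dots,2n$: if $\pi(i)$ is even then $i<2n$ and $\pi(i)>\pi(i+1)$; if $\pi(i)$ is odd then $i=2n$ or $\pi(i)<\pi(i+1)$. $\mathfrak D^1_{2n}$ is the set of these (for $n=0$, just the empty permutation), and $\mathfrak D^1_{2n}(132)$ is the subset of those avoiding $132$. $\mathrm{lis}(\pi)$ is the length of the longest increasing subsequence of $\pi$ ($0$ for the empty permutation). Generating functions are formal power series. *)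

theory Defs
  imports
    "HOL-Combinatorics.Permutations"
    "HOL-Computational_Algebra.Formal_Power_Series"
begin

text \<open>
  An element of the symmetric group on N letters is a function \<open>\<sigma> :: nat \<Rightarrow> nat\<close> with
  \<open>\<sigma> permutes {1..N}\<close>; such a function is the identity outside \<open>{1..N}\<close>, so the
  correspondence is one-to-one and cardinalities are the intended ones. The size \<open>N\<close> is not
  determined by the function and is passed explicitly.
\<close>

definition contains_pattern :: "nat \<Rightarrow> (nat \<Rightarrow> nat) \<Rightarrow> nat \<Rightarrow> (nat \<Rightarrow> nat) \<Rightarrow> bool" where
  "contains_pattern N \<sigma> k \<tau> \<longleftrightarrow>
     (\<exists>i :: nat \<Rightarrow> nat. strict_mono_on {1..k} i \<and> i ` {1..k} \<subseteq> {1..N} \<and>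
        (\<forall>a\<in>{1..k}. \<forall>b\<in>{1..k}. \<sigma> (i a) < \<sigma> (i b) \<longleftrightarrow> \<tau> a < \<tau> b))"

definition avoids_pattern :: "nat \<Rightarrow> (nat \<Rightarrow> nat) \<Rightarrow> nat \<Rightarrow> (nat \<Rightarrow> nat) \<Rightarrow> bool" where
  "avoids_pattern N \<sigma> k \<tau> \<longleftrightarrow> \<not> contains_pattern N \<sigma> k \<tau>"

definition pat132 :: "nat \<Rightarrow> nat" where
  "pat132 = id(2 := 3, 3 := 2)"

text \<open>The argument is \<open>n\<close>, not the size \<open>2 * n\<close>.\<close>

definition dumont1 :: "nat \<Rightarrow> (nat \<Rightarrow> nat) set" where
  "dumont1 n = {\<pi>. \<pi> permutes {1..2 * n} \<and>
     (\<forall>i\<in>{1..2 * n}.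
        (even (\<pi> i) \<longrightarrow> i < 2 * n \<and> \<pi> i > \<pi> (i + 1)) \<and>
        (odd (\<pi> i) \<longrightarrow> i = 2 * n \<or> \<pi> i < \<pi> (i + 1)))}"

definition dumont1_132 :: "nat \<Rightarrow> (nat \<Rightarrow> nat) set" where
  "dumont1_132 n = {\<pi> \<in> dumont1 n. avoids_pattern (2 * n) \<pi> 3 pat132}"

text \<open>
  A subsequence is given by its set \<open>S\<close> of positions. The empty set always qualifies, so the
  maximum is over a finite nonempty set, and it is \<open>0\<close> for \<open>N = 0\<close>.
\<close>

definition lis :: "nat \<Rightarrow> (nat \<Rightarrow> nat) \<Rightarrow> nat" where
  "lis N \<pi> = Max {card S | S. S \<subseteq> {1..N} \<and> strict_mono_on S \<pi>}"

text \<open>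
  The index is an integer so that the convention for index \<open>-1\<close> is available; only indices
  \<open>k \<ge> -1\<close> are meaningful. Coefficients are rational because division of
  power series requires a field.
\<close>

definition L :: "int \<Rightarrow> rat fps" where
  "L k = (if k < 0 then 0
          else Abs_fps (\<lambda>n. of_nat (card {\<pi> \<in> dumont1_132 n. int (lis (2 * n) \<pi>) \<le> k})))"

end

theory Submission
  imports Defs "HOL-Library.Sublist"
begin

text \<open>
  Write a nonempty permutation in one-line notation as \<open>P, 2n+2, Q\<close>. Avoiding \<open>132\<close> puts all
  values of \<open>P\<close> above those of \<open>Q\<close>, so \<open>Q\<close> uses \<open>{1..m}\<close>, and \<open>Q\<close> is nonempty because the even
  maximum must be followed by a descent. If \<open>m\<close> is odd, \<open>m\<close> ends \<open>Q\<close>, and \<open>P\<close> is empty since its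
  least value \<open>m+1\<close> would be even without a descent after it; the word is \<open>2n+2, \<sigma>, 2n+1\<close> and has
  longest increasing subsequence one longer than that of \<open>\<sigma>\<close>. If \<open>m = 2i\<close> is even, the odd value
  \<open>2n+1\<close> must stand directly before \<open>2n+2\<close>; the word is \<open>\<rho>+2i, 2n+1, 2n+2, \<tau>\<close> with \<open>\<tau>\<close> nonempty,
  and the longest increasing subsequence is the maximum of that of \<open>\<rho>\<close> plus \<open>2\<close> and that of \<open>\<tau>\<close>.
  Hence \<open>L\<^sub>k - 1 = z L\<^sub>k\<^sub>-\<^sub>1 + z L\<^sub>k\<^sub>-\<^sub>2 (L\<^sub>k - 1)\<close>.
\<close>

section \<open>Word versions of the three conditions\<close>

text \<open>A last entry must be odd because an even one has no descent after it. The condition is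
  local and free of the size, so it applies to any factor of a word.\<close>

fun dumont_list :: "nat list \<Rightarrow> bool" where
  "dumont_list [] \<longleftrightarrow> True"
| "dumont_list [x] \<longleftrightarrow> odd x"
| "dumont_list (x # y # zs) \<longleftrightarrow> (if even x then y < x else x < y) \<and> dumont_list (y # zs)"

text \<open>An entry \<open>x\<close> is the 1 of an occurrence of 132 exactly when two later
  entries above \<open>x\<close> form an inversion.\<close>

fun avoids132_list :: "nat list \<Rightarrow> bool" where
  "avoids132_list [] \<longleftrightarrow> True"
| "avoids132_list (x # xs) \<longleftrightarrow> sorted (filter (\<lambda>y. x < y) xs) \<and> avoids132_list xs"

text \<open>An upper bound, unlike a maximum, splits into a conjunction over blocks of a word. The
  integer \<open>k\<close> allows \<open>k - 2\<close> without truncation; for negative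
  \<open>k\<close> the empty subsequence already violates the bound.\<close>

definition lis_le :: "int \<Rightarrow> nat list \<Rightarrow> bool" where
  "lis_le k xs \<longleftrightarrow> (\<forall>ys. subseq ys xs \<and> sorted_wrt (<) ys \<longrightarrow> int (length ys) \<le> k)"

definition dumont_lists :: "int \<Rightarrow> nat \<Rightarrow> nat list set" where
  "dumont_lists k n = {xs. distinct xs \<and> set xs = {1..2 * n} \<and> dumont_list xs \<and>
     avoids132_list xs \<and> lis_le k xs}"

section \<open>Concatenation, appended maxima and shifts\<close>

text \<open>The last entry of \<open>xs\<close> must be odd in either reading: at the end of a word,
  and before the larger \<open>y\<close>, where no descent follows.\<close>

lemma dumont_list_append_greater:
  assumes "\<forall>x\<in>set xs. x < y"
  shows "dumont_list (xs @ y # ys) \<longleftrightarrow> dumont_list xs \<and> dumont_list (y # ys)"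
  using assms by (induction xs rule: dumont_list.induct) auto

lemma dumont_list_appendD: "dumont_list (xs @ ys) \<Longrightarrow> dumont_list ys"
proof (induction xs)
  case (Cons x xs)
  then show ?case by (cases "xs @ ys") auto
qed simp

text \<open>An even \<open>x\<close> cannot end the word; any entry that follows is smaller, which
  is all that \<open>x\<close> demands.\<close>

lemma dumont_list_Cons_greater:
  assumes "even x" "\<forall>y\<in>set ys. y < x"
  shows "dumont_list (x # ys) \<longleftrightarrow> ys \<noteq> [] \<and> dumont_list ys"
  using assms by (cases ys) auto

text \<open>An even shift preserves both parity and order.\<close>

lemma dumont_list_map_add: "even m \<Longrightarrow> dumont_list (map (\<lambda>x. x + m) xs) \<longleftrightarrow> dumont_list xs"
  by (induction xs rule: dumont_list.induct) auto

text \<open>An occurrence of 132 whose 1 lies in \<open>xs\<close> has its other two entries above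
  that 1, hence also in \<open>xs\<close>.\<close>

lemma avoids132_list_append_less:
  assumes "\<forall>x\<in>set xs. \<forall>y\<in>set ys. y < x"
  shows "avoids132_list (xs @ ys) \<longleftrightarrow> avoids132_list xs \<and> avoids132_list ys"
  using assms
proof (induction xs)
  case (Cons x xs)
  then have "filter (\<lambda>y. x < y) ys = []" by (auto simp: filter_empty_conv)
  with Cons show ?case by auto
qed simp

text \<open>As the last entry, \<open>y\<close> could only be the 2 of an occurrence, but the 3
  would have to exceed it.\<close>

lemma avoids132_list_snoc_greater:
  assumes "\<forall>x\<in>set xs. x < y"
  shows "avoids132_list (xs @ [y]) \<longleftrightarrow> avoids132_list xs"
  using assms by (induction xs) (auto simp: sorted_append less_imp_le)

lemma avoids132_list_map_add: "avoids132_list (map (\<lambda>x. x + m) xs) \<longleftrightarrow> avoids132_list xs"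
  by (induction xs) (auto simp: filter_map o_def sorted_map sorted_wrt_map)

text \<open>If \<open>x < z\<close>, the entries \<open>x\<close>, \<open>y\<close>,
  \<open>z\<close> would form the pattern 132.\<close>

lemma avoids132_list_middleD:
  assumes "avoids132_list (xs @ y # ys)" "x \<in> set xs" "z \<in> set ys" "z < y"
  shows "z \<le> x"
  using assms by (induction xs) (auto simp: sorted_append not_less[symmetric])

lemma lis_le_nonneg: "lis_le k xs \<Longrightarrow> 0 \<le> k"
  unfolding lis_le_def by (metis list.size(3) of_nat_0 sorted_wrt.simps(1) list_emb_Nil)

text \<open>No increasing subsequence uses both blocks, since it would descend on passing from
  \<open>xs\<close> to \<open>ys\<close>.\<close>

lemma lis_le_append_less:
  assumes "\<forall>x\<in>set xs. \<forall>y\<in>set ys. y < x"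
  shows "lis_le k (xs @ ys) \<longleftrightarrow> lis_le k xs \<and> lis_le k ys"
proof (intro iffI conjI)
  assume "lis_le k xs \<and> lis_le k ys"
  show "lis_le k (xs @ ys)"
    unfolding lis_le_def
  proof (intro allI impI)
    fix zs assume zs: "subseq zs (xs @ ys) \<and> sorted_wrt (<) zs"
    then obtain us vs where uv: "zs = us @ vs" "subseq us xs" "subseq vs ys"
      by (metis subseq_appendE)
    have "us = [] \<or> vs = []"
    proof (rule ccontr)
      assume "\<not> ?thesis"
      then have "hd us \<in> set us" "hd vs \<in> set vs" by auto
      moreover from this have "hd us \<in> set xs" "hd vs \<in> set ys"
        using uv by (auto elim: list_emb_set)
      ultimately have "hd us < hd vs" "hd vs < hd us"
        using zs uv assms by (auto simp: sorted_wrt_append)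
      then show False by simp
    qed
    with uv zs \<open>lis_le k xs \<and> lis_le k ys\<close> show "int (length zs) \<le> k"
      by (auto simp: lis_le_def)
  qed
qed (auto simp: lis_le_def)

text \<open>Every increasing subsequence of \<open>xs\<close> extends by \<open>y\<close>, and
  dropping \<open>y\<close> costs at most one entry.\<close>

lemma lis_le_snoc_greater:
  assumes "\<forall>x\<in>set xs. x < y"
  shows "lis_le k (xs @ [y]) \<longleftrightarrow> lis_le (k - 1) xs"
proof
  assume L: "lis_le k (xs @ [y])"
  show "lis_le (k - 1) xs"
    unfolding lis_le_def
  proof (intro allI impI)
    fix zs assume zs: "subseq zs xs \<and> sorted_wrt (<) zs"
    have "subseq (zs @ [y]) (xs @ [y])" using zs by simp
    moreover have "sorted_wrt (<) (zs @ [y])"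
      using zs assms by (auto simp: sorted_wrt_append dest: list_emb_set)
    ultimately have "int (length (zs @ [y])) \<le> k" using L unfolding lis_le_def by blast
    then show "int (length zs) \<le> k - 1" by simp
  qed
next
  assume L: "lis_le (k - 1) xs"
  show "lis_le k (xs @ [y])"
    unfolding lis_le_def
  proof (intro allI impI)
    fix zs assume zs: "subseq zs (xs @ [y]) \<and> sorted_wrt (<) zs"
    then obtain us vs where uv: "zs = us @ vs" "subseq us xs" "subseq vs [y]"
      by (metis subseq_appendE)
    then have "int (length us) \<le> k - 1" using L zs by (auto simp: lis_le_def sorted_wrt_append)
    moreover have "length vs \<le> 1" using list_emb_length[OF uv(3)] by simp
    ultimately show "int (length zs) \<le> k" using uv by simp
  qed
qed

lemma subseq_map_iff: "subseq ys (map f xs) \<longleftrightarrow> (\<exists>zs. subseq zs xs \<and> ys = map f zs)"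
proof
  assume "subseq ys (map f xs)"
  then show "\<exists>zs. subseq zs xs \<and> ys = map f zs"
    by (simp add: subseq_conv_nths) (metis nths_map)
qed (auto simp: subseq_map)

text \<open>Subsequences are taken before applying \<open>f\<close>; when \<open>xs\<close> lists
  positions and \<open>f\<close> is a permutation, \<open>zs\<close> records a choice of
  positions.\<close>

lemma lis_le_map:
  "lis_le k (map f xs) \<longleftrightarrow>
     (\<forall>zs. subseq zs xs \<and> sorted_wrt (<) (map f zs) \<longrightarrow> int (length zs) \<le> k)"
  unfolding lis_le_def subseq_map_iff by auto

lemma lis_le_map_add: "lis_le k (map (\<lambda>x. x + m) xs) \<longleftrightarrow> lis_le k xs"
  unfolding lis_le_map by (simp add: lis_le_def sorted_wrt_map)

section \<open>Correspondence between permutations and words\<close>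

lemma dumont_list_conv_nth:
  "dumont_list xs \<longleftrightarrow> (\<forall>i<length xs.
     (even (xs ! i) \<longrightarrow> Suc i < length xs \<and> xs ! Suc i < xs ! i) \<and>
     (odd (xs ! i) \<longrightarrow> Suc i < length xs \<longrightarrow> xs ! i < xs ! Suc i))"
  by (induction xs rule: dumont_list.induct) (auto simp: All_less_Suc2)

lemma avoids132_list_conv_nth:
  "avoids132_list xs \<longleftrightarrow>
     (\<forall>i j k. i < j \<and> j < k \<and> k < length xs \<longrightarrow> \<not> (xs ! i < xs ! k \<and> xs ! k < xs ! j))"
  (is "_ \<longleftrightarrow> ?P xs")
proof (induction xs)
  case (Cons x xs)
  \<comment> \<open>Only the smaller entry of an inversion is compared with \<open>x\<close>; the
    larger one then exceeds \<open>x\<close> as well.\<close>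
  have sorted_filter: "sorted (filter (\<lambda>y. x < y) ys) \<longleftrightarrow>
      (\<forall>j k. j < k \<and> k < length ys \<longrightarrow> \<not> (x < ys ! k \<and> ys ! k < ys ! j))" for ys :: "nat list"
  proof (induction ys)
    case (Cons y ys)
    have "(\<forall>j k. j < k \<and> k < length (y # ys) \<longrightarrow> \<not> (x < (y # ys) ! k \<and> (y # ys) ! k < (y # ys) ! j))
      \<longleftrightarrow> (\<forall>z\<in>set ys. \<not> (x < z \<and> z < y)) \<and>
        (\<forall>j k. j < k \<and> k < length ys \<longrightarrow> \<not> (x < ys ! k \<and> ys ! k < ys ! j))" (is "?l \<longleftrightarrow> ?r")
    proof
      assume l: ?l
      show ?r
        using l[rule_format, of 0 "Suc _"] l[rule_format, of "Suc _" "Suc _"]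
        by (auto simp: in_set_conv_nth)
    next
      assume ?r
      then show ?l by (auto simp: nth_Cons all_set_conv_all_nth split: nat.split)
    qed
    with Cons show ?case by (auto simp: not_less)
  qed simp
  \<comment> \<open>Occurrences are split by whether their first index is that of the head.\<close>
  have "?P (x # xs) \<longleftrightarrow>
      (\<forall>j k. j < k \<and> k < length xs \<longrightarrow> \<not> (x < xs ! k \<and> xs ! k < xs ! j)) \<and> ?P xs" (is "?l \<longleftrightarrow> ?r")
  proof
    assume l: ?l
    show ?r
      using l[rule_format, of 0 "Suc _" "Suc _"] l[rule_format, of "Suc _" "Suc _" "Suc _"] by auto
  next
    assume ?r
    then show ?l by (auto simp: nth_Cons split: nat.split)
  qed
  then show ?case using Cons sorted_filter by simp
qed simp

lemma contains_pat132_iff: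
  "contains_pattern N \<sigma> 3 pat132 \<longleftrightarrow>
     (\<exists>a b c. 1 \<le> a \<and> a < b \<and> b < c \<and> c \<le> N \<and> \<sigma> a < \<sigma> c \<and> \<sigma> c < \<sigma> b)"
proof -
  have s: "{1..3::nat} = {1, 2, 3}" by auto
  show ?thesis
  proof
    assume "contains_pattern N \<sigma> 3 pat132"
    then obtain i where i: "strict_mono_on {1..3::nat} i" "i ` {1..3} \<subseteq> {1..N}"
      "\<forall>a\<in>{1..3}. \<forall>b\<in>{1..3}. \<sigma> (i a) < \<sigma> (i b) \<longleftrightarrow> pat132 a < pat132 b"
      unfolding contains_pattern_def by blast
    have "i 1 < i 2" "i 2 < i 3" using i(1) by (auto simp: strict_mono_on_def)
    moreover have "1 \<le> i 1" "i 3 \<le> N" using i(2) unfolding s by auto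
    moreover have "\<sigma> (i 1) < \<sigma> (i 3)" "\<sigma> (i 3) < \<sigma> (i 2)" using i(3) by (auto simp: s pat132_def)
    ultimately show "\<exists>a b c. 1 \<le> a \<and> a < b \<and> b < c \<and> c \<le> N \<and> \<sigma> a < \<sigma> c \<and> \<sigma> c < \<sigma> b" by blast
  next
    assume "\<exists>a b c. 1 \<le> a \<and> a < b \<and> b < c \<and> c \<le> N \<and> \<sigma> a < \<sigma> c \<and> \<sigma> c < \<sigma> b"
    then obtain a b c where abc: "1 \<le> a" "a < b" "b < c" "c \<le> N" "\<sigma> a < \<sigma> c" "\<sigma> c < \<sigma> b" by blast
    \<comment> \<open>The embedding places the pattern at \<open>a\<close>, \<open>b\<close>,
      \<open>c\<close>; the last branch serves the argument 3.\<close>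
    define i where "i = (\<lambda>x::nat. if x = 1 then a else if x = 2 then b else c)"
    show "contains_pattern N \<sigma> 3 pat132"
      unfolding contains_pattern_def
      by (rule exI[of _ i]) (use abc in \<open>auto simp: i_def s pat132_def strict_mono_on_def\<close>)
  qed
qed

lemma avoids132_list_map_upt:
  "avoids132_list (map \<pi> [1..<Suc N]) \<longleftrightarrow> avoids_pattern N \<pi> 3 pat132"
proof -
  have "(\<exists>i j k. i < j \<and> j < k \<and> k < N \<and> \<pi> (Suc i) < \<pi> (Suc k) \<and> \<pi> (Suc k) < \<pi> (Suc j))
    \<longleftrightarrow> contains_pattern N \<pi> 3 pat132"
    (is "?l \<longleftrightarrow> _")
    unfolding contains_pat132_iff
  proof
    assume ?l
    then obtain i j k where "i < j" "j < k" "k < N" "\<pi> (Suc i) < \<pi> (Suc k)" "\<pi> (Suc k) < \<pi> (Suc j)"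
      by blast
    then show "\<exists>a b c. 1 \<le> a \<and> a < b \<and> b < c \<and> c \<le> N \<and> \<pi> a < \<pi> c \<and> \<pi> c < \<pi> b"
      by (intro exI[of _ "Suc i"] exI[of _ "Suc j"] exI[of _ "Suc k"]) auto
  next
    assume "\<exists>a b c. 1 \<le> a \<and> a < b \<and> b < c \<and> c \<le> N \<and> \<pi> a < \<pi> c \<and> \<pi> c < \<pi> b"
    then obtain a b c where "1 \<le> a" "a < b" "b < c" "c \<le> N" "\<pi> a < \<pi> c" "\<pi> c < \<pi> b" by blast
    then show ?l
      by (intro exI[of _ "a - 1"] exI[of _ "b - 1"] exI[of _ "c - 1"]) auto
  qed
  then show ?thesis
    unfolding avoids_pattern_def avoids132_list_conv_nth by (auto simp del: upt_Suc)
qed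

lemma dumont_list_map_upt:
  "dumont_list (map \<pi> [1..<Suc N]) \<longleftrightarrow> (\<forall>i\<in>{1..N}.
     (even (\<pi> i) \<longrightarrow> i < N \<and> \<pi> i > \<pi> (i + 1)) \<and> (odd (\<pi> i) \<longrightarrow> i = N \<or> \<pi> i < \<pi> (i + 1)))"
proof -
  \<comment> \<open>List indices start at 0, positions of the permutation at 1.\<close>
  have "{1..N} = Suc ` {..<N}" by (simp add: image_Suc_lessThan)
  then show ?thesis
    unfolding dumont_list_conv_nth by (auto simp del: upt_Suc)
qed

text \<open>A subsequence of the increasing list \<open>[1..<Suc N]\<close> amounts to its set of
  positions, and increasing values on it amount to \<open>strict_mono_on\<close>.\<close>

lemma lis_le_map_upt: "lis_le k (map \<pi> [1..<Suc N]) \<longleftrightarrow> int (lis N \<pi>) \<le> k"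
proof -
  let ?S = "{card S | S. S \<subseteq> {1..N} \<and> strict_mono_on S \<pi>}"
  have fin: "finite ?S" by (rule finite_surj[of "Pow {1..N}" _ card]) auto
  \<comment> \<open>The empty set of positions ensures that the maximum is attained.\<close>
  have "card {} \<in> ?S" by (force simp: strict_mono_on_def)
  then have ne: "?S \<noteq> {}" by blast
  have "int (lis N \<pi>) \<le> k \<longleftrightarrow> (\<forall>x\<in>?S. int x \<le> k)"
    unfolding lis_def using Max_in[OF fin ne] Max_ge[OF fin]
    by (meson of_nat_mono order_trans)
  also have "\<dots> \<longleftrightarrow> lis_le k (map \<pi> [1..<Suc N])"
    unfolding lis_le_map
  proof (intro iffI allI ballI impI)
    fix zs assume *: "\<forall>x\<in>?S. int x \<le> k"
      "subseq zs [1..<Suc N] \<and> sorted_wrt (<) (map \<pi> zs)"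
    then obtain I where I: "zs = nths [1..<Suc N] I" by (auto simp: subseq_conv_nths)
    have sz: "sorted zs" "distinct zs" unfolding I by (simp_all add: sorted_nths del: upt_Suc)
    have "strict_mono_on (set zs) \<pi>"
      unfolding strict_mono_on_def
    proof (intro allI impI)
      fix r s assume "r \<in> set zs \<and> s \<in> set zs \<and> r < s"
      then obtain i j where "i < length zs" "j < length zs" "zs ! i = r" "zs ! j = s" "r < s"
        by (auto simp: in_set_conv_nth)
      moreover from this have "i < j" using sz(1) by (metis leD not_le sorted_nth_mono)
      ultimately show "\<pi> r < \<pi> s" using * by (auto simp: sorted_wrt_iff_nth_less)
    qed
    moreover have "set zs \<subseteq> {1..N}"
      using set_nths_subset[of "[1..<Suc N]" I] unfolding I by (auto simp del: upt_Suc)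
    ultimately have "card (set zs) \<in> ?S" by blast
    then show "int (length zs) \<le> k" using * distinct_card[OF sz(2)] by auto
  next
    fix x assume *: "\<forall>zs. subseq zs [1..<Suc N] \<and> sorted_wrt (<) (map \<pi> zs) \<longrightarrow> int (length zs) \<le> k"
      "x \<in> ?S"
    then obtain S where S: "x = card S" "S \<subseteq> {1..N}" "strict_mono_on S \<pi>" by blast
    have fS: "finite S" using S(2) finite_subset by blast
    have "subseq (sorted_list_of_set S) [1..<Suc N]"
      by (rule sorted_subset_imp_subseq) (use S fS in \<open>auto simp del: upt_Suc\<close>)
    moreover have "sorted_wrt (<) (map \<pi> (sorted_list_of_set S))"
      unfolding sorted_wrt_map
      by (rule sorted_wrt_mono_rel[OF _ strict_sorted_list_of_set])
        (use S(3) fS in \<open>auto simp: strict_mono_on_def\<close>)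
    ultimately have "int (length (sorted_list_of_set S)) \<le> k" using * by blast
    then show "int x \<le> k" using S(1) by simp
  qed
  finally show ?thesis by simp
qed

lemma bij_betw_permutes_lists:
  "bij_betw (\<lambda>\<pi>. map \<pi> [1..<Suc N]) {\<pi>. \<pi> permutes {1..N}} {xs. distinct xs \<and> set xs = {1..N}}"
  unfolding bij_betw_def
proof
  show "inj_on (\<lambda>\<pi>. map \<pi> [1..<Suc N]) {\<pi>. \<pi> permutes {1..N}}"
  proof (rule inj_onI)
    fix \<pi> \<rho> assume *: "\<pi> \<in> {\<pi>. \<pi> permutes {1..N}}" "\<rho> \<in> {\<pi>. \<pi> permutes {1..N}}"
      "map \<pi> [1..<Suc N] = map \<rho> [1..<Suc N]"
    show "\<pi> = \<rho>"
    proof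
      fix i show "\<pi> i = \<rho> i"
        using * by (cases "i \<in> {1..N}") (auto simp: permutes_def map_eq_conv simp del: upt_Suc)
    qed
  qed
next
  show "(\<lambda>\<pi>. map \<pi> [1..<Suc N]) ` {\<pi>. \<pi> permutes {1..N}} = {xs. distinct xs \<and> set xs = {1..N}}"
  proof (intro equalityI subsetI)
    fix xs assume "xs \<in> (\<lambda>\<pi>. map \<pi> [1..<Suc N]) ` {\<pi>. \<pi> permutes {1..N}}"
    then obtain \<pi> where \<pi>: "\<pi> permutes {1..N}" "xs = map \<pi> [1..<Suc N]" by blast
    then show "xs \<in> {xs. distinct xs \<and> set xs = {1..N}}"
      using permutes_image[OF \<pi>(1)] permutes_inj_on[OF \<pi>(1)]
      by (simp add: distinct_map atLeastLessThanSuc_atLeastAtMost del: upt_Suc)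
  next
    fix xs assume "xs \<in> {xs. distinct xs \<and> set xs = {1..N}}"
    then have xs: "distinct xs" "set xs = {1..N}" by auto
    then have len: "length xs = N" using distinct_card by fastforce
    \<comment> \<open>Position \<open>i\<close> reads list index \<open>i - 1\<close>; fixing
      everything outside \<open>{1..N}\<close> is what \<open>permutes\<close> demands.\<close>
    define \<pi> where "\<pi> = (\<lambda>i. if i \<in> {1..N} then xs ! (i - 1) else i)"
    have map: "xs = map \<pi> [1..<Suc N]"
      by (rule nth_equalityI) (auto simp: len \<pi>_def simp del: upt_Suc)
    have "bij_betw \<pi> {1..N} {1..N}"
      using xs map by (metis bij_betw_def distinct_map set_map set_upt atLeastLessThanSuc_atLeastAtMost)
    then have "\<pi> permutes {1..N}"
      by (rule bij_imp_permutes) (auto simp: \<pi>_def)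
    with map show "xs \<in> (\<lambda>\<pi>. map \<pi> [1..<Suc N]) ` {\<pi>. \<pi> permutes {1..N}}" by blast
  qed
qed

text \<open>For negative \<open>k\<close> the bound excludes even the empty word, which matches the
  convention that \<open>L\<close> is 0 there.\<close>

lemma L_conv_dumont_lists: "L k = Abs_fps (\<lambda>n. of_nat (card (dumont_lists k n)))"
proof (cases "k < 0")
  case True
  then have "dumont_lists k n = {}" for n using lis_le_nonneg by (fastforce simp: dumont_lists_def)
  with True show ?thesis by (simp add: L_def fps_eq_iff)
next
  case False
  have "card {\<pi> \<in> dumont1_132 n. int (lis (2 * n) \<pi>) \<le> k} = card (dumont_lists k n)" for n
  proof (rule bij_betw_same_card)
    let ?f = "\<lambda>\<pi>. map \<pi> [1..<Suc (2 * n)]"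
    let ?A = "{\<pi>. \<pi> permutes {1..2 * n}}" and ?B = "{xs. distinct xs \<and> set xs = {1..2 * n}}"
    let ?P = "\<lambda>xs. dumont_list xs \<and> avoids132_list xs \<and> lis_le k xs"
    have "bij_betw ?f {\<pi> \<in> ?A. ?P (?f \<pi>)} {xs \<in> ?B. ?P xs}"
      using bij_betw_permutes_lists[of "2 * n"] unfolding bij_betw_def
      by (auto simp: inj_on_def simp del: upt_Suc)
    also have "{\<pi> \<in> ?A. ?P (?f \<pi>)} = {\<pi> \<in> dumont1_132 n. int (lis (2 * n) \<pi>) \<le> k}"
      unfolding dumont_list_map_upt avoids132_list_map_upt lis_le_map_upt
      by (auto simp: dumont1_132_def dumont1_def)
    also have "{xs \<in> ?B. ?P xs} = dumont_lists k n" by (auto simp: dumont_lists_def)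
    finally show "bij_betw ?f {\<pi> \<in> dumont1_132 n. int (lis (2 * n) \<pi>) \<le> k} (dumont_lists k n)" .
  qed
  with False show ?thesis by (simp add: L_def)
qed

lemma finite_dumont_lists: "finite (dumont_lists k n)"
proof (rule finite_subset)
  show "dumont_lists k n \<subseteq> {xs. set xs \<subseteq> {1..2 * n} \<and> length xs = 2 * n}"
    unfolding dumont_lists_def using distinct_card by fastforce
qed (simp add: finite_lists_length_eq)

lemma dumont_lists_0: "k \<ge> 0 \<Longrightarrow> dumont_lists k 0 = {[]}"
  by (auto simp: dumont_lists_def lis_le_def dest: list_emb_Nil2)

text \<open>The head of a nonempty word is an increasing subsequence of length one.\<close>

lemma dumont_lists_0_Suc: "dumont_lists 0 (Suc n) = {}"
proof -
  have False if "xs \<in> dumont_lists 0 (Suc n)" for xs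
  proof -
    have "set xs \<noteq> {}" using that by (auto simp: dumont_lists_def)
    then have "subseq [hd xs] xs" unfolding subseq_singleton_left by simp
    then show False using that by (force simp: dumont_lists_def lis_le_def)
  qed
  then show ?thesis by blast
qed

section \<open>Decomposition at the largest entry\<close>

definition wrap_top :: "nat \<Rightarrow> nat list \<Rightarrow> nat list" where
  "wrap_top n \<sigma> = (2 * n + 2) # \<sigma> @ [2 * n + 1]"

text \<open>In use, \<open>i\<close> is half the length of \<tau> and \<open>n - i\<close> half that
  of \<rho>; the lift by \<open>2 * i\<close> puts \<rho> above every entry of \<tau>.\<close>

definition join_top :: "nat \<Rightarrow> nat \<Rightarrow> nat list \<Rightarrow> nat list \<Rightarrow> nat list" where
  "join_top n i \<rho> \<tau> = map (\<lambda>x. x + 2 * i) \<rho> @ (2 * n + 1) # (2 * n + 2) # \<tau>"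

text \<open>The leading \<open>2 * n + 2\<close> exceeds all that follows, so it starts no 132 and
  no increasing pair; the final \<open>2 * n + 1\<close> extends every increasing subsequence of
  \<sigma>, which lowers the bound by one.\<close>

lemma wrap_top_mem:
  assumes "distinct \<sigma>" "set \<sigma> = {1..2 * n}"
  shows "wrap_top n \<sigma> \<in> dumont_lists k (Suc n) \<longleftrightarrow> \<sigma> \<in> dumont_lists (k - 1) n"
proof -
  have 1: "dumont_list (wrap_top n \<sigma>) \<longleftrightarrow> dumont_list \<sigma>"
    unfolding wrap_top_def
    using assms by (subst dumont_list_Cons_greater) (auto simp: dumont_list_append_greater)
  have 2: "avoids132_list (wrap_top n \<sigma>) \<longleftrightarrow> avoids132_list \<sigma>"
    using assms avoids132_list_append_less[of "[2 * n + 2]" "\<sigma> @ [2 * n + 1]"]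
      avoids132_list_snoc_greater[of \<sigma> "2 * n + 1"]
    by (auto simp: wrap_top_def)
  \<comment> \<open>The singleton is written \<open>[] @ [2 * n + 2]\<close> so that
    \<open>lis_le_snoc_greater\<close> rewrites both conjuncts.\<close>
  have "lis_le k (wrap_top n \<sigma>) \<longleftrightarrow> lis_le k ([] @ [2 * n + 2]) \<and> lis_le k (\<sigma> @ [2 * n + 1])"
    using assms lis_le_append_less[of "[2 * n + 2]" "\<sigma> @ [2 * n + 1]"]
    by (auto simp: wrap_top_def)
  also have "\<dots> \<longleftrightarrow> lis_le (k - 1) [] \<and> lis_le (k - 1) \<sigma>"
    using assms by (subst (1 2) lis_le_snoc_greater) auto
  \<comment> \<open>The bound on the empty word only says \<open>0 \<le> k - 1\<close>, which the
    bound on \<sigma> implies.\<close>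
  also have "\<dots> \<longleftrightarrow> lis_le (k - 1) \<sigma>" using lis_le_nonneg[of "k - 1" \<sigma>]
    by (auto simp: lis_le_def dest: list_emb_Nil2)
  finally show ?thesis
    using assms 1 2 by (auto simp: dumont_lists_def wrap_top_def)
qed

text \<open>The word is peeled from the right: the low block \<tau> splits off, two successive
  maxima each lower the bound on \<rho> by one, and the even shift changes none of the
  conditions.\<close>

lemma join_top_mem:
  assumes "distinct \<rho>" "set \<rho> = {1..2 * (n - i)}" "distinct \<tau>" "set \<tau> = {1..2 * i}" "1 \<le> i" "i \<le> n"
  shows "join_top n i \<rho> \<tau> \<in> dumont_lists k (Suc n) \<longleftrightarrow>
    \<rho> \<in> dumont_lists (k - 2) (n - i) \<and> \<tau> \<in> dumont_lists k i"
proof -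
  let ?\<rho> = "map (\<lambda>x. x + 2 * i) \<rho>"
  have split: "join_top n i \<rho> \<tau> = ((?\<rho> @ [2 * n + 1]) @ [2 * n + 2]) @ \<tau>" by (simp add: join_top_def)
  have s\<rho>: "set ?\<rho> = {2 * i + 1..2 * n}"
  proof -
    have "set ?\<rho> = (\<lambda>x. x + 2 * i) ` {1..2 * (n - i)}" using assms(2) by simp
    also have "\<dots> = {1 + 2 * i..2 * (n - i) + 2 * i}" by (rule image_add_atLeastAtMost')
    also have "\<dots> = {2 * i + 1..2 * n}" using assms(6) by auto
    finally show ?thesis .
  qed
  then have lt: "\<forall>x\<in>set ?\<rho>. x < 2 * n + 1" "\<forall>x\<in>set (?\<rho> @ [2 * n + 1]). x < 2 * n + 2"
    "\<forall>x\<in>set ((?\<rho> @ [2 * n + 1]) @ [2 * n + 2]). \<forall>y\<in>set \<tau>. y < x"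
    using assms by auto
  \<comment> \<open>The even \<open>2 * n + 2\<close> needs a descent after it; this is where
    \<open>1 \<le> i\<close> enters.\<close>
  have "\<tau> \<noteq> []" using assms by auto
  then have 1: "dumont_list (join_top n i \<rho> \<tau>) \<longleftrightarrow> dumont_list \<rho> \<and> dumont_list \<tau>"
    using lt dumont_list_Cons_greater[of "2 * n + 2" \<tau>]
    unfolding join_top_def by (subst dumont_list_append_greater) (auto simp: dumont_list_map_add)
  have 2: "avoids132_list (join_top n i \<rho> \<tau>) \<longleftrightarrow> avoids132_list \<rho> \<and> avoids132_list \<tau>"
    unfolding split avoids132_list_append_less[OF lt(3)] avoids132_list_snoc_greater[OF lt(2)]
      avoids132_list_snoc_greater[OF lt(1)] avoids132_list_map_add ..
  have 3: "lis_le k (join_top n i \<rho> \<tau>) \<longleftrightarrow> lis_le (k - 2) \<rho> \<and> lis_le k \<tau>"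
    unfolding split lis_le_append_less[OF lt(3)] lis_le_snoc_greater[OF lt(2)]
      lis_le_snoc_greater[OF lt(1)] lis_le_map_add by simp
  have "distinct (join_top n i \<rho> \<tau>)"
    using assms lt s\<rho> by (auto simp: join_top_def distinct_map inj_on_def)
  moreover have "set (join_top n i \<rho> \<tau>) = {1..2 * Suc n}"
    using assms s\<rho> by (auto simp: join_top_def)
  ultimately show ?thesis using assms 1 2 3 by (auto simp: dumont_lists_def)
qed

text \<open>A gap of \<open>B\<close> below \<open>Max B\<close> would be filled by an element of
  \<open>A\<close>, yet those lie above all of \<open>B\<close>; so \<open>B\<close> is an initial
  segment.\<close>

lemma card_initial_interval:
  fixes A B :: "nat set"
  assumes "A \<union> B = {1..M}" "\<forall>a\<in>A. \<forall>b\<in>B. b < a"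
  shows "B = {1..card B}" "A = {card B + 1..M}"
proof -
  have fin: "finite A" "finite B" using assms(1) by (metis finite_Un finite_atLeastAtMost)+
  have "\<exists>m\<le>M. B = {1..m}"
  proof (cases "B = {}")
    case False
    have "Max B \<in> B" using False fin by simp
    have "x \<in> B" if "x \<in> {1..Max B}" for x
    proof (rule ccontr)
      assume "x \<notin> B"
      moreover have "Max B \<le> M" using \<open>Max B \<in> B\<close> assms(1) by auto
      ultimately have "x \<in> A" using that assms(1) by auto
      then show False using assms(2) \<open>Max B \<in> B\<close> that by fastforce
    qed
    moreover have "x \<in> {1..Max B}" if "x \<in> B" for x using that fin assms(1) by auto
    ultimately have "B = {1..Max B}" by blast
    moreover have "Max B \<le> M" using \<open>Max B \<in> B\<close> assms(1) by auto
    ultimately show ?thesis by blast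
  qed auto
  then obtain m where m: "m \<le> M" "B = {1..m}" by blast
  then show "B = {1..card B}" by simp
  have "A \<inter> B = {}" using assms(2) by blast
  then have "A = {1..M} - {1..m}" using assms(1) m(2) by blast
  then show "A = {card B + 1..M}" using m by auto
qed

text \<open>An odd entry that is not last is followed by something larger.\<close>

lemma dumont_list_max_odd_last:
  assumes "dumont_list (xs @ m # ys)" "odd m" "\<forall>y\<in>set ys. y \<le> m"
  shows "ys = []"
  using dumont_list_appendD[OF assms(1)] assms(2,3) by (cases ys) auto

lemma dumont_lists_Suc_cases:
  assumes "xs \<in> dumont_lists k (Suc n)"
  shows "(\<exists>\<sigma>. distinct \<sigma> \<and> set \<sigma> = {1..2 * n} \<and> xs = wrap_top n \<sigma>) \<or>
    (\<exists>i \<rho> \<tau>. 1 \<le> i \<and> i \<le> n \<and> distinct \<rho> \<and> set \<rho> = {1..2 * (n - i)} \<and>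
       distinct \<tau> \<and> set \<tau> = {1..2 * i} \<and> xs = join_top n i \<rho> \<tau>)"
proof -
  have xs: "distinct xs" "set xs = {1..2 * n + 2}" "dumont_list xs" "avoids132_list xs"
    using assms by (auto simp: dumont_lists_def)
  then have "2 * n + 2 \<in> set xs" by simp
  then obtain P Q where PQ: "xs = P @ (2 * n + 2) # Q" by (meson split_list)
  have un: "set P \<union> set Q = {1..2 * n + 1}"
  proof -
    have "set P \<union> set Q = set xs - {2 * n + 2}" using xs(1) PQ by auto
    then show ?thesis using xs(2) by auto
  qed
  have less: "\<forall>p\<in>set P. \<forall>q\<in>set Q. q < p"
  proof (intro ballI)
    fix p q assume pq: "p \<in> set P" "q \<in> set Q"
    then have "q \<le> 2 * n + 1" using un by auto
    then have "q \<le> p" using avoids132_list_middleD[of P "2 * n + 2" Q p q] xs(4) PQ pq by simp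
    moreover have "q \<noteq> p" using xs(1) PQ pq by auto
    ultimately show "q < p" by simp
  qed
  define m where "m = card (set Q)"
  have sets: "set Q = {1..m}" "set P = {m + 1..2 * n + 1}"
    using card_initial_interval[OF un less] by (simp_all add: m_def)
  have dQ: "dumont_list ((2 * n + 2) # Q)" using dumont_list_appendD xs(3) PQ by blast
  then have "Q \<noteq> []" by auto
  then have "1 \<le> m" using sets(1) by (metis atLeastatMost_empty_iff set_empty)
  have "set Q \<subseteq> {1..2 * n + 1}" using un by blast
  then have "m \<le> 2 * n + 1" using sets(1) \<open>1 \<le> m\<close> by auto
  show ?thesis
  proof (cases "odd m")
    case True
    have "m \<in> set Q" using sets \<open>1 \<le> m\<close> by simp
    then obtain Q1 Q2 where Q: "Q = Q1 @ m # Q2" by (meson split_list)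
    have "Q2 = []"
      by (rule dumont_list_max_odd_last[of "(2 * n + 2) # Q1" m])
        (use dQ Q True sets(1) in auto)
    have "P = []"
    proof (rule ccontr)
      assume "P \<noteq> []"
      then have "set P \<noteq> {}" by simp
      then have "m + 1 \<in> set P" unfolding sets(2) by auto
      then obtain P1 P2 where P: "P = P1 @ (m + 1) # P2" by (meson split_list)
      have "dumont_list ((m + 1) # P2 @ (2 * n + 2) # Q)"
        using dumont_list_appendD[of P1] xs(3) PQ P by simp
      moreover have "\<forall>x\<in>set P2. m + 1 \<le> x" using P sets(2) by auto
      moreover have "m + 1 < 2 * n + 2" using \<open>m + 1 \<in> set P\<close> sets(2) by simp
      \<comment> \<open>The entry after \<open>m + 1\<close> is the head of \<open>P2\<close> or
        \<open>2 * n + 2\<close>; neither is smaller, although the even \<open>m + 1\<close>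
        requires a descent.\<close>
      ultimately show False using True by (cases P2) auto
    qed
    then have "{m + 1..2 * n + 1} = {}" using sets(2) by simp
    then have "m = 2 * n + 1" using \<open>m \<le> 2 * n + 1\<close> by simp
    then have "xs = wrap_top n Q1" using PQ Q \<open>P = []\<close> \<open>Q2 = []\<close> by (simp add: wrap_top_def)
    moreover have "distinct Q1" using calculation xs(1) by (simp add: wrap_top_def)
    moreover have "set Q1 = {1..2 * n}"
    proof -
      have "set Q1 = set Q - {m}" using xs(1) PQ Q \<open>Q2 = []\<close> by auto
      then show ?thesis using sets(1) \<open>m = 2 * n + 1\<close> by auto
    qed
    ultimately show ?thesis by blast
  next
    case False
    then obtain i where i: "m = 2 * i" by blast
    then have "1 \<le> i" "i \<le> n" using \<open>1 \<le> m\<close> \<open>m \<le> 2 * n + 1\<close> by auto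
    then have "2 * n + 1 \<in> set P" using sets(2) i by auto
    then obtain P1 P2 where P: "P = P1 @ (2 * n + 1) # P2" by (meson split_list)
    have "dumont_list ((2 * n + 1) # P2 @ (2 * n + 2) # Q)"
      using dumont_list_appendD[of P1] xs(3) PQ P by simp
    moreover have "\<forall>x\<in>set P2. x \<le> 2 * n + 1" using P sets(2) by auto
    \<comment> \<open>An entry of \<open>P2\<close> directly after the odd \<open>2 * n + 1\<close>
      would have to exceed it.\<close>
    ultimately have "P2 = []" by (cases P2) auto
    have sP1: "set P1 = {m + 1..2 * n}"
    proof -
      have "set P1 = set P - {2 * n + 1}" using xs(1) PQ P \<open>P2 = []\<close> by auto
      then show ?thesis using sets(2) by auto
    qed
    \<comment> \<open>All entries of \<open>P1\<close> exceed \<open>2 * i\<close>, so the truncated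
      subtraction is undone by adding \<open>2 * i\<close> back.\<close>
    define \<rho> where "\<rho> = map (\<lambda>x. x - 2 * i) P1"
    have "map (\<lambda>x. x + 2 * i) \<rho> = P1"
      unfolding \<rho>_def map_map by (rule map_idI) (use sP1 i in auto)
    then have "xs = join_top n i \<rho> Q" using PQ P \<open>P2 = []\<close> by (simp add: join_top_def)
    moreover have "distinct \<rho>"
      using xs(1) PQ P sP1 i by (auto simp: \<rho>_def distinct_map inj_on_def)
    moreover have "set \<rho> = {1..2 * (n - i)}"
    proof -
      have "set \<rho> = (\<lambda>x. x - 2 * i) ` {2 * i + 1..2 * n}" using sP1 i by (simp add: \<rho>_def)
      also have "\<dots> = {1..2 * (n - i)}"
        by (auto simp: image_iff diff_mult_distrib2 intro!: bexI[of _ "_ + 2 * i"])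
      finally show ?thesis .
    qed
    moreover have "distinct Q" "set Q = {1..2 * i}" using xs(1) PQ sets(1) i by auto
    ultimately show ?thesis using \<open>1 \<le> i\<close> \<open>i \<le> n\<close> by blast
  qed
qed

text \<open>The case analysis supplies the shape of a word, and the membership equivalences carry
  the bound between the word and its pieces.\<close>

lemma dumont_lists_Suc:
  "dumont_lists k (Suc n) = wrap_top n ` dumont_lists (k - 1) n \<union>
     (\<lambda>(i, \<rho>, \<tau>). join_top n i \<rho> \<tau>) ` (SIGMA i:{1..n}. dumont_lists (k - 2) (n - i) \<times> dumont_lists k i)"
  (is "_ = ?A \<union> ?B")
proof (intro equalityI subsetI)
  fix xs assume xs: "xs \<in> dumont_lists k (Suc n)"
  from dumont_lists_Suc_cases[OF xs] show "xs \<in> ?A \<union> ?B"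
  proof (elim disjE exE conjE)
    fix \<sigma> assume "distinct \<sigma>" "set \<sigma> = {1..2 * n}" "xs = wrap_top n \<sigma>"
    then show ?thesis using xs wrap_top_mem by blast
  next
    fix i \<rho> \<tau>
    assume *: "1 \<le> i" "i \<le> n" "distinct \<rho>" "set \<rho> = {1..2 * (n - i)}"
       "distinct \<tau>" "set \<tau> = {1..2 * i}" "xs = join_top n i \<rho> \<tau>"
    then have "\<rho> \<in> dumont_lists (k - 2) (n - i) \<and> \<tau> \<in> dumont_lists k i"
      using xs join_top_mem by blast
    then have "(i, \<rho>, \<tau>) \<in> (SIGMA i:{1..n}. dumont_lists (k - 2) (n - i) \<times> dumont_lists k i)"
      using * by simp
    then show ?thesis using * by force
  qed
next
  fix xs assume "xs \<in> ?A \<union> ?B"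
  then show "xs \<in> dumont_lists k (Suc n)"
  proof
    assume "xs \<in> ?A"
    then obtain \<sigma> where \<sigma>: "xs = wrap_top n \<sigma>" "\<sigma> \<in> dumont_lists (k - 1) n" by blast
    then have "distinct \<sigma>" "set \<sigma> = {1..2 * n}" by (simp_all add: dumont_lists_def)
    then show ?thesis using \<sigma> wrap_top_mem by blast
  next
    assume "xs \<in> ?B"
    then obtain i \<rho> \<tau> where *: "xs = join_top n i \<rho> \<tau>" "1 \<le> i" "i \<le> n"
      "\<rho> \<in> dumont_lists (k - 2) (n - i)" "\<tau> \<in> dumont_lists k i" by auto
    then have "distinct \<rho>" "set \<rho> = {1..2 * (n - i)}" "distinct \<tau>" "set \<tau> = {1..2 * i}"
      by (simp_all add: dumont_lists_def)
    then show ?thesis using * join_top_mem by blast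
  qed
qed

section \<open>Counting the two families\<close>

text \<open>Both constructions are injective with disjoint images, so their counts add, and for each
  \<open>i\<close> the choices of \<rho> and \<tau> multiply.\<close>

lemma card_dumont_lists_Suc:
  "card (dumont_lists k (Suc n)) = card (dumont_lists (k - 1) n) +
     (\<Sum>i=1..n. card (dumont_lists (k - 2) (n - i)) * card (dumont_lists k i))"
proof -
  let ?S = "SIGMA i:{1..n}. dumont_lists (k - 2) (n - i) \<times> dumont_lists k i"
  let ?j = "\<lambda>(i, \<rho>, \<tau>). join_top n i \<rho> \<tau>"
  have set_eq: "set xs = {1..2 * i}" if "xs \<in> dumont_lists l i" for xs l i
    using that by (simp add: dumont_lists_def)
  have "inj_on (wrap_top n) (dumont_lists (k - 1) n)"
    by (auto simp: inj_on_def wrap_top_def)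
  then have 1: "card (wrap_top n ` dumont_lists (k - 1) n) = card (dumont_lists (k - 1) n)"
    by (rule card_image)
  have "inj_on ?j ?S"
  proof (rule inj_onI)
    fix p q assume pq: "p \<in> ?S" "q \<in> ?S" "?j p = ?j q"
    obtain i \<rho> \<tau> where p: "p = (i, \<rho>, \<tau>)" by (cases p)
    obtain i' \<rho>' \<tau>' where q: "q = (i', \<rho>', \<tau>')" by (cases q)
    have i: "i \<le> n" "1 \<le> i" "set \<rho> = {1..2 * (n - i)}" "set \<tau> = {1..2 * i}"
      using pq(1) p set_eq by auto
    have i': "i' \<le> n" "1 \<le> i'" "set \<rho>' = {1..2 * (n - i')}" "set \<tau>' = {1..2 * i'}"
      using pq(2) q set_eq by auto
    \<comment> \<open>The value \<open>2 * n + 1\<close> marks the cut: its absence from the prefix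
      of one word and the suffix of the other forces the two cuts to agree.\<close>
    have "2 * n + 1 \<notin> set (map (\<lambda>x. x + 2 * i) \<rho>)" using i by auto
    moreover have "2 * n + 1 \<notin> set ((2 * n + 2) # \<tau>')" using i' by auto
    moreover have "map (\<lambda>x. x + 2 * i) \<rho> @ (2 * n + 1) # (2 * n + 2) # \<tau> =
      map (\<lambda>x. x + 2 * i') \<rho>' @ (2 * n + 1) # (2 * n + 2) # \<tau>'"
      using pq(3) p q by (simp add: join_top_def)
    ultimately have eq: "map (\<lambda>x. x + 2 * i) \<rho> = map (\<lambda>x. x + 2 * i') \<rho>'" "\<tau> = \<tau>'"
      using i i' by (subst (asm) append_Cons_eq_iff; force)+
    \<comment> \<open>The shift is recovered from the size of the value set of \<tau>.\<close>
    have "{1..2 * i} = {1..2 * i'}" using eq(2) unfolding i(4)[symmetric] i'(4)[symmetric] by simp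
    then have "card {1..2 * i} = card {1..2 * i'}" by (rule arg_cong)
    then have "i = i'" by simp
    then show "p = q" using eq p q by (simp add: inj_map_eq_map)
  qed
  then have 2: "card (?j ` ?S) = (\<Sum>i=1..n. card (dumont_lists (k - 2) (n - i)) * card (dumont_lists k i))"
    by (simp add: card_image finite_dumont_lists card_cartesian_product)
  have disj: "wrap_top n ` dumont_lists (k - 1) n \<inter> ?j ` ?S = {}"
  proof -
    have "wrap_top n \<sigma> \<noteq> join_top n i \<rho> \<tau>" if "(i, \<rho>, \<tau>) \<in> ?S" for \<sigma> i \<rho> \<tau>
    proof
      assume eq: "wrap_top n \<sigma> = join_top n i \<rho> \<tau>"
      have \<tau>: "set \<tau> = {1..2 * i}" "1 \<le> i" "i \<le> n" using that set_eq by auto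
      then have "\<tau> \<noteq> []" by auto
      \<comment> \<open>The last entry tells the shapes apart: \<open>2 * n + 1\<close> after
        wrapping, at most \<open>2 * n\<close> after joining.\<close>
      then have "last (wrap_top n \<sigma>) \<in> set \<tau>" unfolding eq by (simp add: join_top_def)
      then show False using \<tau> by (simp add: wrap_top_def)
    qed
    then show ?thesis by fast
  qed
  show ?thesis
    unfolding dumont_lists_Suc[of k n]
    by (subst card_Un_disjoint[OF _ _ disj])
      (simp_all only: 1 2, auto intro!: finite_imageI finite_SigmaI finite_dumont_lists)
qed

section \<open>Passage to generating functions\<close>

text \<open>A joined word has nonempty \<tau>, hence the factor \<open>L k - 1\<close>; each
  \<open>fps_X\<close> accounts for the two new largest entries.\<close>

lemma L_recurrence:
  includes fps_syntax
  assumes "k \<ge> 0"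
  shows "L k - 1 = fps_X * L (k - 1) + (L k - 1) * (fps_X * L (k - 2))"
proof (rule fps_ext)
  fix m
  have 0: "(L k - 1) $ 0 = 0" by (simp add: L_conv_dumont_lists dumont_lists_0 assms)
  show "(L k - 1) $ m = (fps_X * L (k - 1) + (L k - 1) * (fps_X * L (k - 2))) $ m"
  proof (cases m)
    case 0
    with \<open>(L k - 1) $ 0 = 0\<close> show ?thesis by (simp add: fps_mult_nth)
  next
    case (Suc n)
    \<comment> \<open>With \<open>fps_X\<close> in front, the coefficient index drops from
      \<open>Suc n\<close> to \<open>n\<close>.\<close>
    have "(L k - 1) * (fps_X * L (k - 2)) = fps_X * ((L k - 1) * L (k - 2))" by (simp add: mult_ac)
    then have "((L k - 1) * (fps_X * L (k - 2))) $ m = ((L k - 1) * L (k - 2)) $ n"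
      unfolding Suc by (simp only: fps_X_mult_nth) simp
    also have "\<dots> = (\<Sum>i=0..n. (L k - 1) $ i * L (k - 2) $ (n - i))" by (rule fps_mult_nth)
    \<comment> \<open>The term for \<open>i = 0\<close> vanishes with the constant term of
      \<open>L k - 1\<close>.\<close>
    also have "\<dots> = (\<Sum>i=1..n. (L k - 1) $ i * L (k - 2) $ (n - i))"
      using 0 by (simp add: sum.atLeast_Suc_atMost)
    also have "\<dots> = (\<Sum>i=1..n. of_nat (card (dumont_lists (k - 2) (n - i)) * card (dumont_lists k i)))"
      by (rule sum.cong) (auto simp: L_conv_dumont_lists mult_ac)
    finally show ?thesis
      using Suc by (simp add: L_conv_dumont_lists card_dumont_lists_Suc)
  qed
qed

theorem theorem2p1:
  shows "L 0 = 1 \<and>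
    (\<forall>k::int. k \<ge> 1 \<longrightarrow>
       L k = 1 + (fps_X * L (k - 1)) / (1 - fps_X * L (k - 2)))"
proof (intro conjI allI impI)
  show "L 0 = 1"
  proof (rule fps_ext)
    fix n show "fps_nth (L 0) n = fps_nth 1 n"
      by (cases n) (simp_all add: L_conv_dumont_lists dumont_lists_0 dumont_lists_0_Suc)
  qed
next
  fix k :: int assume "k \<ge> 1"
  let ?d = "1 - fps_X * L (k - 2)"
  \<comment> \<open>Constant term 1 makes the divisor nonzero, so it can be cancelled.\<close>
  have "fps_nth ?d 0 = 1" by simp
  then have "?d \<noteq> 0" by (metis fps_zero_nth zero_neq_one)
  moreover have "(L k - 1) * ?d = fps_X * L (k - 1)"
    using L_recurrence[of k] \<open>k \<ge> 1\<close> by (simp add: algebra_simps)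
  ultimately have "L k - 1 = (fps_X * L (k - 1)) / ?d"
    by (metis nonzero_mult_div_cancel_right)
  then show "L k = 1 + (fps_X * L (k - 1)) / ?d" by (simp add: algebra_simps)
qed

end
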